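(* Let $n,m\geq1$ be integers. Let $W\in C^{2,\alpha}(\mathbb{R}^m,\mathbb{R})$ (with $0<\alpha<1$) be a non-negative potential which is convex in a closed set $F\subset\mathbb{R}^m$, in the sense that $D^2W(v)(\xi,\xi)\geq0$ for all $v\in F$ and all $\xi\in\mathbb{R}^m$. Let $u\in C^2(\mathbb{R}^n;\mathbb{R}^m)\cap L^\infty(\mathbb{R}^n;\mathbb{R}^m)$ be a solution of $\Delta u=\nabla W(u)$ on all of $\mathbb{R}^n$. Set $$\epsilon:=\inf_{\mathbb{R}^m\setminus F}W,\qquad S:=\sup_{x\in u^{-1}(\mathbb{R}^m\setminus F)}|\nabla u(x)|^2.$$ If $0<S<\frac{2\epsilon}{n}$, then $$\frac n2|\nabla u(x)|^2\leq\frac{\epsilon}{S}|\nabla u(x)|^2\leq W(u(x))\qquad\text{for all }x\in\mathbb{R}^n.$$ In addition, if $S=0$ or $u(\mathbb{R}^n)\subset F$, then $u$ is constant.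
   Context: $|\cdot|$ is the Euclidean norm, and $|\nabla u|^2=\sum_{i=1}^n|u_{x_i}|^2$ where $u_{x_i}=\partial u/\partial x_i\in\mathbb{R}^m$. $D^2W(v)(\xi,\xi)$ is the Hessian quadratic form of $W$ at $v$. The conditions on $S$ ($0<S<2\epsilon/n$, or $S=0$) concern the case where $u^{-1}(\mathbb{R}^m\setminus F)$ is non-empty; the case where it is empty is the case $u(\mathbb{R}^n)\subset F$. *)

theory Defs
  imports "HOL-Analysis.Analysis"
begin

definition partial_diff_at :: "'n::finite \<Rightarrow> (real^'n \<Rightarrow> 'b::real_normed_vector) \<Rightarrow> real^'n \<Rightarrow> bool"
  where "partial_diff_at i f x \<longleftrightarrow> (\<lambda>t. f (x + t *\<^sub>R axis i 1)) differentiable (at 0)"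

definition pderivative :: "'n::finite \<Rightarrow> (real^'n \<Rightarrow> 'b::real_normed_vector) \<Rightarrow> real^'n \<Rightarrow> 'b"
  where "pderivative i f x = vector_derivative (\<lambda>t. f (x + t *\<^sub>R axis i 1)) (at 0)"

text \<open>All partial derivatives of order at most \<open>k\<close> exist and are continuous on the whole space;
  no bound on them is required.\<close>

primrec Ck :: "nat \<Rightarrow> (real^'n::finite \<Rightarrow> 'b::real_normed_vector) \<Rightarrow> bool" where
  "Ck 0 f \<longleftrightarrow> continuous_on UNIV f"
| "Ck (Suc k) f \<longleftrightarrow> continuous_on UNIV f \<and>
     (\<forall>i. (\<forall>x. partial_diff_at i f x) \<and> Ck k (pderivative i f))"

definition locally_hoelder :: "real \<Rightarrow> (real^'n::finite \<Rightarrow> 'b::real_normed_vector) \<Rightarrow> bool"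
  where "locally_hoelder \<alpha> g \<longleftrightarrow>
    (\<forall>K. compact K \<longrightarrow> (\<exists>C. \<forall>x\<in>K. \<forall>y\<in>K. norm (g x - g y) \<le> C * norm (x - y) powr \<alpha>))"

text \<open>The convention of Gilbarg and Trudinger for \<open>C\<^sup>2\<^sup>,\<^sup>\<alpha>\<close> on an open set (here the whole space):
  the second derivatives are Hoelder continuous on every compact set. Functions with a finite
  global \<open>C\<^sup>2\<^sup>,\<^sup>\<alpha>\<close> norm satisfy this in particular.\<close>

definition C2_hoelder :: "real \<Rightarrow> (real^'n::finite \<Rightarrow> 'b::real_normed_vector) \<Rightarrow> bool"
  where "C2_hoelder \<alpha> f \<longleftrightarrow>
    Ck 2 f \<and> (\<forall>i j. locally_hoelder \<alpha> (pderivative i (pderivative j f)))"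

definition L_infinity :: "(real^'n::finite \<Rightarrow> 'b::real_normed_vector) \<Rightarrow> bool"
  where "L_infinity f \<longleftrightarrow>
    f \<in> borel_measurable lebesgue \<and> (\<exists>C. AE x in lebesgue. norm (f x) \<le> C)"

definition gradient :: "(real^'n::finite \<Rightarrow> real) \<Rightarrow> real^'n \<Rightarrow> real^'n"
  where "gradient f x = (\<chi> i. pderivative i f x)"

definition hessian_form :: "(real^'n::finite \<Rightarrow> real) \<Rightarrow> real^'n \<Rightarrow> real^'n \<Rightarrow> real^'n \<Rightarrow> real"
  where "hessian_form f x \<xi> \<eta> = (\<Sum>i\<in>UNIV. \<Sum>j\<in>UNIV. pderivative i (pderivative j f) x * \<xi> $ i * \<eta> $ j)"

definition laplacian :: "(real^'n::finite \<Rightarrow> 'b::real_normed_vector) \<Rightarrow> real^'n \<Rightarrow> 'b"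
  where "laplacian f x = (\<Sum>i\<in>UNIV. pderivative i (pderivative i f) x)"

definition grad_norm_sq :: "(real^'n::finite \<Rightarrow> real^'m::finite) \<Rightarrow> real^'n \<Rightarrow> real"
  where "grad_norm_sq u x = (\<Sum>i\<in>UNIV. (norm (pderivative i u x))\<^sup>2)"

text \<open>Infimum and supremum are taken in the extended reals, so that no boundedness or
  non-emptiness is presupposed: an empty infimum is \<open>\<infinity>\<close>, an empty supremum is \<open>-\<infinity>\<close>.\<close>

definition inf_outside :: "(real^'m::finite \<Rightarrow> real) \<Rightarrow> (real^'m) set \<Rightarrow> ereal"
  where "inf_outside W F = (INF v\<in>- F. ereal (W v))"

definition sup_grad_outside :: "(real^'n::finite \<Rightarrow> real^'m::finite) \<Rightarrow> (real^'m) set \<Rightarrow> ereal"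
  where "sup_grad_outside u F = (SUP x\<in>u -` (- F). ereal (grad_norm_sq u x))"

end

theory Submission imports Defs
begin

text \<open>Put \<open>P = c \<bar>\<nabla>u\<bar>\<^sup>2 - W(u)\<close> with \<open>c > n/2\<close>. Where \<open>u \<in> F\<close>, formally
  \<open>\<Delta>P \<ge> 2c \<bar>D\<^sup>2u\<bar>\<^sup>2 - \<bar>\<Delta>u\<bar>\<^sup>2\<close>, and \<open>\<bar>\<Delta>u\<bar>\<^sup>2 \<le> n \<bar>D\<^sup>2u\<bar>\<^sup>2\<close>, so there is a surplus
  \<open>\<kappa> \<bar>\<Delta>u\<bar>\<^sup>2\<close>. If \<open>P \<le> 0\<close> outside \<open>u\<^sup>-\<^sup>1(F)\<close> but \<open>P(y) > 0\<close> somewhere, consider a maximum point of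
  \<open>P + \<delta> \<bar>u\<bar>\<^sup>2/2 - \<eta> \<bar>x\<bar>\<^sup>2\<close>; it exists because \<open>\<nabla>u\<close> is bounded. There \<open>P > 0\<close>, hence \<open>u \<in> F\<close>
  and \<open>\<bar>\<nabla>u\<bar>\<^sup>2\<close> is bounded below; the term \<open>\<delta>(\<bar>\<nabla>u\<bar>\<^sup>2 + u \<cdot> \<Delta>u)\<close>, with the surplus absorbing
  \<open>u \<cdot> \<Delta>u\<close>, makes the Laplacian positive when \<open>\<eta>\<close> is small. So \<open>P \<le> 0\<close> everywhere. The first claim is
  \<open>c = \<epsilon>/S\<close>; in the remaining cases every large \<open>c\<close> is admissible, which forces \<open>\<nabla>u = 0\<close>.\<close>

section \<open>Directional derivatives\<close>

text \<open>A relation between whole functions rather than a statement at one point: second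
  derivatives are then obtained by chaining it, and sums, products and compositions are
  differentiated by introduction rules. With \<open>e = axis i 1\<close> it is the partial
  derivative.\<close>

definition has_dir_derivative ::
  "'a::real_normed_vector \<Rightarrow> ('a \<Rightarrow> 'b::real_normed_vector) \<Rightarrow> ('a \<Rightarrow> 'b) \<Rightarrow> bool"
  where "has_dir_derivative e f g \<longleftrightarrow>
    (\<forall>x. ((\<lambda>t. f (x + t *\<^sub>R e)) has_vector_derivative g x) (at 0))"

lemma has_dir_derivativeD:
  assumes "has_dir_derivative e f g"
  shows "((\<lambda>t. f (x + t *\<^sub>R e)) has_vector_derivative g (x + t *\<^sub>R e)) (at t)"
proof -
  have "((\<lambda>s. f ((x + t *\<^sub>R e) + s *\<^sub>R e)) has_vector_derivative g (x + t *\<^sub>R e)) (at (t - t))"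
    using assms by (simp add: has_dir_derivative_def)
  moreover have "((\<lambda>s::real. s - t) has_vector_derivative 1) (at t)"
    by (auto intro!: derivative_eq_intros)
  ultimately have "((\<lambda>s. f ((x + t *\<^sub>R e) + s *\<^sub>R e)) \<circ> (\<lambda>s. s - t) has_vector_derivative
      1 *\<^sub>R g (x + t *\<^sub>R e)) (at t)"
    by (intro vector_diff_chain_at) auto
  then show ?thesis
    by (simp add: o_def algebra_simps)
qed

lemma has_dir_derivative_shift:
  assumes "has_dir_derivative e f g"
  shows "has_dir_derivative e (\<lambda>x. f (x + a)) (\<lambda>x. g (x + a))"
  unfolding has_dir_derivative_def
proof
  fix x
  have "((\<lambda>t. f (x + a + t *\<^sub>R e)) has_vector_derivative g (x + a)) (at 0)"
    using assms by (simp add: has_dir_derivative_def)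
  then show "((\<lambda>t. f (x + t *\<^sub>R e + a)) has_vector_derivative g (x + a)) (at 0)"
    by (simp add: add_ac)
qed

lemma has_dir_derivative_const: "has_dir_derivative e (\<lambda>x. c) (\<lambda>x. 0)"
  by (simp add: has_dir_derivative_def)

lemma has_dir_derivative_ident: "has_dir_derivative e (\<lambda>x. x) (\<lambda>x. e)"
  unfolding has_dir_derivative_def by (auto intro!: derivative_eq_intros)

lemma has_dir_derivative_add:
  "has_dir_derivative e f f' \<Longrightarrow> has_dir_derivative e g g' \<Longrightarrow>
    has_dir_derivative e (\<lambda>x. f x + g x) (\<lambda>x. f' x + g' x)"
  unfolding has_dir_derivative_def by (auto intro: has_vector_derivative_add)

lemma has_dir_derivative_diff:
  "has_dir_derivative e f f' \<Longrightarrow> has_dir_derivative e g g' \<Longrightarrow>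
    has_dir_derivative e (\<lambda>x. f x - g x) (\<lambda>x. f' x - g' x)"
  unfolding has_dir_derivative_def by (auto intro: has_vector_derivative_diff)

lemma has_dir_derivative_sum:
  "(\<And>i. i \<in> I \<Longrightarrow> has_dir_derivative e (f i) (f' i)) \<Longrightarrow>
    has_dir_derivative e (\<lambda>x. \<Sum>i\<in>I. f i x) (\<lambda>x. \<Sum>i\<in>I. f' i x)"
  unfolding has_dir_derivative_def by (auto intro: has_vector_derivative_sum)

lemma has_dir_derivative_bounded_linear:
  "bounded_linear L \<Longrightarrow> has_dir_derivative e f f' \<Longrightarrow>
    has_dir_derivative e (\<lambda>x. L (f x)) (\<lambda>x. L (f' x))"
  unfolding has_dir_derivative_def by (auto intro: bounded_linear.has_vector_derivative)

lemmas has_dir_derivative_scaleR =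
  has_dir_derivative_bounded_linear[OF bounded_linear_scaleR_right]

lemmas has_dir_derivative_mult =
  has_dir_derivative_bounded_linear[OF bounded_linear_mult_right]

lemmas has_dir_derivative_vec_nth =
  has_dir_derivative_bounded_linear[OF bounded_linear_vec_nth]

lemma has_dir_derivative_bilinear:
  assumes "bounded_bilinear P" "has_dir_derivative e f f'" "has_dir_derivative e g g'"
  shows "has_dir_derivative e (\<lambda>x. P (f x) (g x)) (\<lambda>x. P (f x) (g' x) + P (f' x) (g x))"
  unfolding has_dir_derivative_def
proof
  fix x
  show "((\<lambda>t. P (f (x + t *\<^sub>R e)) (g (x + t *\<^sub>R e))) has_vector_derivative
      P (f x) (g' x) + P (f' x) (g x)) (at 0)"
    using bounded_bilinear.has_vector_derivative[OF assms(1)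
        has_dir_derivativeD[OF assms(2), of x 0] has_dir_derivativeD[OF assms(3), of x 0]] by simp
qed

lemmas has_dir_derivative_inner = has_dir_derivative_bilinear[OF bounded_bilinear_inner]

text \<open>Meant for reflections: \<open>R\<close> maps lines of direction \<open>e\<close> to
  lines of direction \<open>e'\<close>, so the chain rule only exchanges the direction.\<close>

lemma has_dir_derivative_affine:
  assumes "has_dir_derivative e' f g" and "\<And>x t. R (x + t *\<^sub>R e) = R x + t *\<^sub>R e'"
  shows "has_dir_derivative e (\<lambda>x. f (R x)) (\<lambda>x. g (R x))"
  using assms unfolding has_dir_derivative_def by auto

lemma has_dir_derivative_uminus:
  assumes "has_dir_derivative e f g"
  shows "has_dir_derivative (- e) f (\<lambda>x. - g x)"
  unfolding has_dir_derivative_def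
proof
  fix x
  have "((\<lambda>s. f (x + s *\<^sub>R e)) has_vector_derivative g x) (at (- 0))"
    using assms by (simp add: has_dir_derivative_def)
  moreover have "((\<lambda>s::real. - s) has_vector_derivative - 1) (at 0)"
    by (auto intro!: derivative_eq_intros)
  ultimately have "((\<lambda>s. f (x + s *\<^sub>R e)) \<circ> (\<lambda>s. - s) has_vector_derivative (- 1) *\<^sub>R g x) (at 0)"
    by (intro vector_diff_chain_at) auto
  then show "((\<lambda>t. f (x + t *\<^sub>R - e)) has_vector_derivative - g x) (at 0)"
    by (simp add: o_def)
qed

lemma has_dir_derivative_compose:
  assumes "has_dir_derivative e f f'" and "\<And>y. (g has_derivative g' y) (at y)"
  shows "has_dir_derivative e (\<lambda>x. g (f x)) (\<lambda>x. g' (f x) (f' x))"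
  unfolding has_dir_derivative_def
proof
  fix x
  have "((\<lambda>t. f (x + t *\<^sub>R e)) has_derivative (\<lambda>t. t *\<^sub>R f' x)) (at 0)"
    using assms(1) by (simp add: has_dir_derivative_def has_vector_derivative_def)
  moreover have "(g has_derivative g' (f x)) (at (f (x + 0 *\<^sub>R e)))"
    using assms(2)[of "f x"] by simp
  ultimately have "((\<lambda>t. g (f (x + t *\<^sub>R e))) has_derivative (\<lambda>t. g' (f x) (t *\<^sub>R f' x))) (at 0)"
    by (rule has_derivative_compose)
  moreover have "linear (g' (f x))"
    by (rule has_derivative_linear[OF assms(2)])
  ultimately show "((\<lambda>t. g (f (x + t *\<^sub>R e))) has_vector_derivative g' (f x) (f' x)) (at 0)"
    by (simp add: has_vector_derivative_def linear_scale)
qed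

text \<open>Mean value inequality for f minus the linear function \<open>t *\<^sub>R c\<close> on
  the segment. With \<open>c = 0\<close> it is a Lipschitz bound, with \<open>c = g x\<close> a
  first-order remainder estimate.\<close>

lemma has_dir_derivative_increment:
  assumes "has_dir_derivative e f g"
    and "\<And>t. t \<in> closed_segment 0 h \<Longrightarrow> norm (g (x + t *\<^sub>R e) - c) \<le> B"
  shows "norm (f (x + h *\<^sub>R e) - f x - h *\<^sub>R c) \<le> B * \<bar>h\<bar>"
proof -
  define \<phi> where "\<phi> t = f (x + t *\<^sub>R e) - t *\<^sub>R c" for t
  have "(\<phi> has_derivative (\<lambda>s. s *\<^sub>R (g (x + t *\<^sub>R e) - c))) (at t within closed_segment 0 h)" for t
  proof -
    have "(\<phi> has_vector_derivative g (x + t *\<^sub>R e) - c) (at t)"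
      unfolding \<phi>_def
      by (auto intro!: derivative_eq_intros has_dir_derivativeD[OF assms(1)])
    then show ?thesis
      by (auto simp: has_vector_derivative_def intro: has_derivative_at_withinI)
  qed
  moreover have "onorm (\<lambda>s::real. s *\<^sub>R (g (x + t *\<^sub>R e) - c)) \<le> B"
    if "t \<in> closed_segment 0 h" for t
  proof (rule onorm_le)
    fix s :: real
    show "norm (s *\<^sub>R (g (x + t *\<^sub>R e) - c)) \<le> B * norm s"
      using mult_right_mono[OF assms(2)[OF that] abs_ge_zero[of s]] by (simp add: mult.commute)
  qed
  ultimately have "norm (\<phi> h - \<phi> 0) \<le> B * norm (h - 0)"
    by (intro differentiable_bound[of "closed_segment 0 h"]) auto
  then show ?thesis
    by (simp add: \<phi>_def algebra_simps)
qed

text \<open>If \<open>h x\<close> were positive, \<open>g\<close>, which vanishes at the maximum,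
  would be positive just beyond \<open>x\<close> along \<open>e\<close>; by the mean value theorem
  \<open>f\<close> would exceed \<open>f x\<close> there.\<close>

lemma second_dir_derivative_nonpos_at_max:
  fixes f :: "'a::real_normed_vector \<Rightarrow> real"
  assumes f: "has_dir_derivative e f g" and g: "has_dir_derivative e g h"
    and max: "eventually (\<lambda>t. f (x + t *\<^sub>R e) \<le> f x) (at 0)"
  shows "h x \<le> 0"
proof (rule ccontr)
  assume "\<not> h x \<le> 0"
  then have pos: "0 < h x" by simp
  have df: "((\<lambda>t. f (x + t *\<^sub>R e)) has_real_derivative g (x + t *\<^sub>R e)) (at t)" for t
    using has_dir_derivativeD[OF f] by (simp add: has_real_derivative_iff_has_vector_derivative)
  have dg: "((\<lambda>t. g (x + t *\<^sub>R e)) has_real_derivative h (x + 0 *\<^sub>R e)) (at 0)"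
    using has_dir_derivativeD[OF g, of x 0] by (simp add: has_real_derivative_iff_has_vector_derivative)
  obtain d where d: "d > 0" "\<And>t. t \<noteq> 0 \<Longrightarrow> \<bar>t\<bar> < d \<Longrightarrow> f (x + t *\<^sub>R e) \<le> f x"
    using max unfolding eventually_at by (auto simp: dist_real_def)
  have "g (x + 0 *\<^sub>R e) = 0"
  proof (rule DERIV_local_max[OF df d(1)])
    show "\<forall>t. \<bar>0 - t\<bar> < d \<longrightarrow> f (x + t *\<^sub>R e) \<le> f (x + 0 *\<^sub>R e)"
    proof (intro allI impI)
      fix t assume "\<bar>0 - t\<bar> < d"
      then show "f (x + t *\<^sub>R e) \<le> f (x + 0 *\<^sub>R e)" using d(2)[of t] by (cases "t = 0") auto
    qed
  qed
  moreover obtain d' where d': "d' > 0" "\<And>t. 0 < t \<Longrightarrow> t < d' \<Longrightarrow> g (x + 0 *\<^sub>R e) < g (x + t *\<^sub>R e)"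
    using DERIV_pos_inc_right[OF dg] pos by auto
  ultimately have gpos: "0 < g (x + t *\<^sub>R e)" if "0 < t" "t < d'" for t
    using that by force
  define s where "s = min d d' / 2"
  have s: "0 < s" "s < d" "s < d'" using d(1) d'(1) by (auto simp: s_def)
  obtain z where z: "0 < z" "z < s" "f (x + s *\<^sub>R e) - f (x + 0 *\<^sub>R e) = (s - 0) * g (x + z *\<^sub>R e)"
    using MVT2[OF s(1) df] by auto
  have "0 < g (x + z *\<^sub>R e)" using gpos z s by auto
  then have "f x < f (x + s *\<^sub>R e)" using z(3) s(1) by (simp add: algebra_simps)
  then show False using d(2)[of s] s by auto
qed

section \<open>Difference quotients as substitutes for derivatives\<close>

definition diff_quotient ::
  "real \<Rightarrow> 'a::real_normed_vector \<Rightarrow> ('a \<Rightarrow> 'b::real_normed_vector) \<Rightarrow> 'a \<Rightarrow> 'b"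
  where "diff_quotient h e f x = (1 / h) *\<^sub>R (f (x + h *\<^sub>R e) - f x)"

text \<open>Differencing loses no regularity, whereas taking a derivative costs one order; this is
  why quotients can stand in for first derivatives of a function that is only twice
  differentiable.\<close>

lemma has_dir_derivative_diff_quotient:
  assumes "has_dir_derivative e f g"
  shows "has_dir_derivative e (diff_quotient h e' f) (diff_quotient h e' g)"
  unfolding diff_quotient_def
  by (intro has_dir_derivative_scaleR has_dir_derivative_diff has_dir_derivative_shift assms)

lemma diff_quotient_sum:
  "(\<Sum>i\<in>I. diff_quotient h e (f i) x) = diff_quotient h e (\<lambda>x. \<Sum>i\<in>I. f i x) x"
  by (simp add: diff_quotient_def scaleR_right.sum[symmetric] sum_subtractf)

lemma continuous_on_diff_quotient:
  assumes "continuous_on UNIV f"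
  shows "continuous_on UNIV (diff_quotient h e f)"
  unfolding diff_quotient_def
  by (intro continuous_intros continuous_on_compose2[OF assms]) auto

lemma norm_diff_quotient_le:
  assumes "has_dir_derivative e f g" and "\<And>x. norm (g x) \<le> L" and "h \<noteq> 0"
  shows "norm (diff_quotient h e f x) \<le> L"
proof -
  have "norm (f (x + h *\<^sub>R e) - f x) \<le> L * \<bar>h\<bar>"
    using has_dir_derivative_increment[OF assms(1), of h x 0 L] assms(2) by simp
  moreover have "norm (diff_quotient h e f x) = norm (f (x + h *\<^sub>R e) - f x) / \<bar>h\<bar>"
    by (simp add: diff_quotient_def del: scaleR_diff_right)
  ultimately show ?thesis
    using assms(3) by (simp add: divide_le_eq)
qed

text \<open>The base points \<open>X k\<close> may move together with the step sizes, as needed for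
  maximisers depending on the step. Continuity of \<open>g\<close> at \<open>x\<close> makes
  \<open>g\<close> nearly \<open>g x\<close> on the whole short segment, and the mean value
  inequality with \<open>c = g x\<close> applies.\<close>

lemma diff_quotient_tendsto:
  fixes X :: "nat \<Rightarrow> 'a::real_normed_vector"
  assumes f: "has_dir_derivative e f g" and cont: "continuous_on UNIV g"
    and X: "X \<longlonglongrightarrow> x" and h: "h \<longlonglongrightarrow> 0" and nz: "\<And>k. h k \<noteq> 0"
  shows "(\<lambda>k. diff_quotient (h k) e f (X k)) \<longlonglongrightarrow> g x"
proof (rule tendstoI)
  fix r :: real assume "r > 0"
  have "isCont g x" using cont by (simp add: continuous_on_eq_continuous_at)
  then obtain d where d: "d > 0" "\<And>z. dist z x < d \<Longrightarrow> dist (g z) (g x) < r / 2"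
    using \<open>r > 0\<close> unfolding continuous_at_eps_delta by (metis half_gt_zero)
  have "(\<lambda>k. norm (X k - x) + \<bar>h k\<bar> * norm e) \<longlonglongrightarrow> norm (x - x) + \<bar>0\<bar> * norm e"
    by (intro tendsto_intros X h)
  then have "eventually (\<lambda>k. norm (X k - x) + \<bar>h k\<bar> * norm e < d) sequentially"
    using d(1) by (auto dest: order_tendstoD(2))
  then show "eventually (\<lambda>k. dist (diff_quotient (h k) e f (X k)) (g x) < r) sequentially"
  proof eventually_elim
    case (elim k)
    have "norm (g (X k + t *\<^sub>R e) - g x) \<le> r / 2" if "t \<in> closed_segment 0 (h k)" for t
    proof -
      have "\<bar>t\<bar> \<le> \<bar>h k\<bar>" using that by (auto simp: closed_segment_eq_real_ivl split: if_splits)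
      then have "\<bar>t\<bar> * norm e \<le> \<bar>h k\<bar> * norm e" by (intro mult_right_mono) auto
      then have "norm (X k - x) + norm (t *\<^sub>R e) < d" using elim by simp
      then have "norm ((X k - x) + t *\<^sub>R e) < d" using norm_triangle_ineq le_less_trans by blast
      then show ?thesis using d(2)[of "X k + t *\<^sub>R e"] by (simp add: dist_norm algebra_simps)
    qed
    then have "norm (f (X k + h k *\<^sub>R e) - f (X k) - h k *\<^sub>R g x) \<le> r / 2 * \<bar>h k\<bar>"
      by (rule has_dir_derivative_increment[OF f])
    moreover have "diff_quotient (h k) e f (X k) - g x
        = (1 / h k) *\<^sub>R (f (X k + h k *\<^sub>R e) - f (X k) - h k *\<^sub>R g x)"
      using nz[of k] by (simp add: diff_quotient_def algebra_simps)
    then have "norm (diff_quotient (h k) e f (X k) - g x)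
        = norm (f (X k + h k *\<^sub>R e) - f (X k) - h k *\<^sub>R g x) / \<bar>h k\<bar>"
      by (simp del: scaleR_diff_right)
    ultimately have "norm (diff_quotient (h k) e f (X k) - g x) \<le> r / 2"
      using nz[of k] by (simp add: divide_le_eq)
    then show ?case using \<open>r > 0\<close> by (simp add: dist_norm)
  qed
qed

section \<open>From continuous partial derivatives to total derivatives\<close>

lemma Ck_has_dir_derivative:
  assumes "Ck (Suc k) f"
  shows "has_dir_derivative (axis i 1) f (pderivative i f)" and "Ck k (pderivative i f)"
  using assms
  by (auto simp: has_dir_derivative_def partial_diff_at_def pderivative_def
      vector_derivative_works[symmetric])

lemma Ck_continuous: "Ck k f \<Longrightarrow> continuous_on UNIV f"
  by (cases k) auto

text \<open>The increment from x to y is split into moves along single coordinates, each controlled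
  by the mean value inequality and the continuity of the corresponding partial derivative.\<close>

lemma Ck1_has_derivative:
  fixes f :: "real^'n::finite \<Rightarrow> 'b::real_normed_vector"
  assumes "Ck 1 f"
  shows "(f has_derivative (\<lambda>v. \<Sum>i\<in>UNIV. v $ i *\<^sub>R pderivative i f x)) (at x)"
  unfolding has_derivative_at_alt
proof (intro conjI allI impI)
  show "bounded_linear (\<lambda>v::real^'n. \<Sum>i\<in>UNIV. v $ i *\<^sub>R pderivative i f x)"
    by (intro bounded_linear_sum bounded_linear_compose[OF bounded_linear_scaleR_left] bounded_linear_vec_nth)
next
  fix r :: real assume "r > 0"
  have dir: "has_dir_derivative (axis i 1) f (pderivative i f)" for i
    using Ck_has_dir_derivative(1)[of 0] assms by simp
  \<comment> \<open>The coordinate errors are added up, each at most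
    \<open>r' * norm (y - x)\<close>.\<close>
  define r' where "r' = r / CARD('n)"
  have "r' > 0" using \<open>r > 0\<close> by (simp add: r'_def)
  have "isCont (pderivative i f) x" for i
    using assms Ck_has_dir_derivative(2)[of 0 f i] by (simp add: continuous_on_eq_continuous_at)
  then have "eventually (\<lambda>z. dist (pderivative i f z) (pderivative i f x) < r') (nhds x)" for i
    using \<open>r' > 0\<close> by (intro tendstoD) (simp_all add: tendsto_at_iff_tendsto_nhds[symmetric] isCont_def)
  then have "eventually (\<lambda>z. \<forall>i. dist (pderivative i f z) (pderivative i f x) < r') (nhds x)"
    by (simp add: eventually_all_finite)
  then obtain d where d: "d > 0"
    "\<And>z i. dist z x < d \<Longrightarrow> dist (pderivative i f z) (pderivative i f x) < r'"
    unfolding eventually_nhds_metric by blast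
  \<comment> \<open>Induction on a set \<open>I\<close> containing all coordinates where y and x
    differ; the step resets coordinate \<open>j\<close> of y to that of x, which gives
    \<open>z\<close>.\<close>
  have tele: "norm (f y - f x - (\<Sum>i\<in>I. (y - x) $ i *\<^sub>R pderivative i f x)) \<le> r' * (\<Sum>i\<in>I. \<bar>(y - x) $ i\<bar>)"
    if "finite I" "\<And>i. i \<notin> I \<Longrightarrow> y $ i = x $ i" "norm (y - x) < d" for I y
    using that
  proof (induction I arbitrary: y rule: finite_induct)
    case empty
    then have "y = x" by (simp add: vec_eq_iff)
    then show ?case by simp
  next
    case (insert j I)
    define h where "h = (y - x) $ j"
    define z where "z = y - h *\<^sub>R axis j 1"
    have zj: "z $ j = x $ j" by (simp add: z_def h_def)
    have zi: "z $ i = y $ i" if "i \<noteq> j" for i using that by (simp add: z_def axis_def)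
    \<comment> \<open>No coordinate is farther from x than that of y, so the segment from
      \<open>z\<close> to y stays in the ball where the partial derivatives are controlled.\<close>
    have below: "norm (z + t *\<^sub>R axis j 1 - x) \<le> norm (y - x)" if "\<bar>t\<bar> \<le> \<bar>h\<bar>" for t
    proof (rule norm_le_componentwise_cart)
      fix i show "norm ((z + t *\<^sub>R axis j 1 - x) $ i) \<le> norm ((y - x) $ i)"
        using that zj zi[of i] by (cases "i = j") (auto simp: h_def axis_def)
    qed
    have "norm (f (z + h *\<^sub>R axis j 1) - f z - h *\<^sub>R pderivative j f x) \<le> r' * \<bar>h\<bar>"
    proof (rule has_dir_derivative_increment[OF dir])
      fix t assume "t \<in> closed_segment 0 h"
      then have "\<bar>t\<bar> \<le> \<bar>h\<bar>" by (auto simp: closed_segment_eq_real_ivl split: if_splits)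
      then have "dist (z + t *\<^sub>R axis j 1) x < d"
        using le_less_trans[OF below insert.prems(2)] by (simp add: dist_norm)
      then show "norm (pderivative j f (z + t *\<^sub>R axis j 1) - pderivative j f x) \<le> r'"
        using d(2) by (simp add: dist_norm less_imp_le)
    qed
    then have 1: "norm (f y - f z - h *\<^sub>R pderivative j f x) \<le> r' * \<bar>h\<bar>"
      by (simp add: z_def)
    have 2: "norm (f z - f x - (\<Sum>i\<in>I. (z - x) $ i *\<^sub>R pderivative i f x)) \<le> r' * (\<Sum>i\<in>I. \<bar>(z - x) $ i\<bar>)"
    proof (rule insert.IH)
      show "z $ i = x $ i" if "i \<notin> I" for i
        using that zi[of i] zj insert.prems(1)[of i] by (cases "i = j") auto
      show "norm (z - x) < d"
        using below[of 0] insert.prems(2) by simp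
    qed
    have eq: "(\<Sum>i\<in>I. (z - x) $ i *\<^sub>R pderivative i f x) = (\<Sum>i\<in>I. (y - x) $ i *\<^sub>R pderivative i f x)"
      "(\<Sum>i\<in>I. \<bar>(z - x) $ i\<bar>) = (\<Sum>i\<in>I. \<bar>(y - x) $ i\<bar>)"
    proof -
      have "(z - x) $ i = (y - x) $ i" if "i \<in> I" for i
        using that zi[of i] insert.hyps(2) by (cases "i = j") auto
      then show "(\<Sum>i\<in>I. (z - x) $ i *\<^sub>R pderivative i f x) = (\<Sum>i\<in>I. (y - x) $ i *\<^sub>R pderivative i f x)"
        "(\<Sum>i\<in>I. \<bar>(z - x) $ i\<bar>) = (\<Sum>i\<in>I. \<bar>(y - x) $ i\<bar>)"
        by (auto intro!: sum.cong simp del: vector_minus_component)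
    qed
    have "f y - f x - (\<Sum>i\<in>insert j I. (y - x) $ i *\<^sub>R pderivative i f x)
      = (f y - f z - h *\<^sub>R pderivative j f x) + (f z - f x - (\<Sum>i\<in>I. (z - x) $ i *\<^sub>R pderivative i f x))"
      unfolding eq sum.insert[OF insert.hyps] h_def[symmetric] by (simp del: vector_minus_component)
    moreover have "r' * (\<Sum>i\<in>insert j I. \<bar>(y - x) $ i\<bar>) = r' * \<bar>h\<bar> + r' * (\<Sum>i\<in>I. \<bar>(z - x) $ i\<bar>)"
      unfolding eq sum.insert[OF insert.hyps] h_def[symmetric] by (rule distrib_left)
    ultimately show ?case
      using norm_triangle_mono[OF 1 2] unfolding eq by (simp only:)
  qed
  show "\<exists>d>0. \<forall>y. norm (y - x) < d \<longrightarrow>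
      norm (f y - f x - (\<Sum>i\<in>UNIV. (y - x) $ i *\<^sub>R pderivative i f x)) \<le> r * norm (y - x)"
  proof (intro exI[of _ d] conjI allI impI d(1))
    fix y assume "norm (y - x) < d"
    then have "norm (f y - f x - (\<Sum>i\<in>UNIV. (y - x) $ i *\<^sub>R pderivative i f x))
        \<le> r' * (\<Sum>i\<in>UNIV. \<bar>(y - x) $ i\<bar>)"
      using tele[of UNIV y] by simp
    also have "(\<Sum>i\<in>UNIV. \<bar>(y - x) $ i\<bar>) \<le> (\<Sum>i\<in>(UNIV::'n set). norm (y - x))"
      by (intro sum_mono component_le_norm_cart)
    then have "r' * (\<Sum>i\<in>UNIV. \<bar>(y - x) $ i\<bar>) \<le> r' * (CARD('n) * norm (y - x))"
      using \<open>r' > 0\<close> by simp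
    finally show "norm (f y - f x - (\<Sum>i\<in>UNIV. (y - x) $ i *\<^sub>R pderivative i f x)) \<le> r * norm (y - x)"
      by (simp add: r'_def)
  qed
qed

section \<open>Gradient bound for bounded functions with bounded Laplacian\<close>

lemma attains_sup_if_le_outside_cball:
  fixes f :: "'a::euclidean_space \<Rightarrow> real"
  assumes "closed T" "continuous_on T f" "y0 \<in> T" "y0 \<in> cball a r"
    and out: "\<And>y. y \<in> T \<Longrightarrow> y \<notin> cball a r \<Longrightarrow> f y \<le> f y0"
  obtains x where "x \<in> T" "x \<in> cball a r" "\<And>y. y \<in> T \<Longrightarrow> f y \<le> f x"
proof -
  have "compact (T \<inter> cball a r)" "T \<inter> cball a r \<noteq> {}" "continuous_on (T \<inter> cball a r) f"
    using assms by (auto intro: closed_Int_compact continuous_on_subset)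
  then obtain x where x: "x \<in> T \<inter> cball a r" "\<And>y. y \<in> T \<inter> cball a r \<Longrightarrow> f y \<le> f x"
    using continuous_attains_sup by metis
  show ?thesis
  proof (rule that)
    fix y assume "y \<in> T"
    then show "f y \<le> f x"
      using x(2)[of y] x(2)[of y0] out[of y] assms(3,4) by force
  qed (use x(1) in auto)
qed

text \<open>Barrier argument on the slab \<open>0 \<le> s \<le> 1\<close> (\<open>s\<close> the signed distance to a hyperplane) for the
  difference of \<open>f\<close> and its reflection, which vanishes for \<open>s = 0\<close> and satisfies the same kind of
  bounds; \<open>-\<bar>y - a\<bar>\<^sup>2/2\<close> makes the maximum be attained.\<close>

lemma reflection_difference_le:
  fixes f :: "real^'n::finite \<Rightarrow> real" and A B :: real
  assumes D1: "\<And>j. has_dir_derivative (axis j 1) f (g j)"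
    and D2: "\<And>j. has_dir_derivative (axis j 1) (g j) (h j)"
    and cont: "continuous_on UNIV f"
    and A: "\<And>x. \<bar>f x\<bar> \<le> A" and B: "\<And>x. \<bar>\<Sum>j\<in>UNIV. h j x\<bar> \<le> B"
    and t: "0 \<le> t" "t \<le> 1"
  shows "f (a + t *\<^sub>R axis i 1) - f (a - t *\<^sub>R axis i 1) \<le> 2 * (2 * A + B + CARD('n) + 1) * t"
proof -
  \<comment> \<open>Two demands fix \<open>K\<close>: it must dominate \<open>2 * A\<close> on the
    face \<open>s = 1\<close>, and \<open>2 * K\<close> must exceed \<open>2 * B + CARD('n)\<close>
    to exclude an interior maximum.\<close>
  define K where "K = 2 * A + B + CARD('n)"
  define s where "s y = y $ i - a $ i" for y :: "real^'n"
  define R where "R y = y - (2 * s y) *\<^sub>R axis i 1" for y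
  \<comment> \<open>\<open>R\<close> is the reflection in the hyperplane \<open>s = 0\<close>. The
    barrier \<open>s * (2 - s)\<close> is 0 on that face, 1 on the other, and has second derivative
    -2 in between.\<close>
  define w where "w y = (f y - f (R y)) - K * (s y * (2 - s y)) - (1 / 2) * ((y - a) \<bullet> (y - a))" for y
  have "0 \<le> A" using A[of 0] by linarith
  have "0 \<le> B" using B[of 0] by linarith
  have "0 < K" "0 \<le> K" using \<open>0 \<le> A\<close> \<open>0 \<le> B\<close> by (auto simp: K_def add_nonneg_pos)
  define \<sigma> where "\<sigma> j = (if j = i then - 1 else 1 :: real)" for j
  define \<delta> where "\<delta> j = (if j = i then 1 else 0 :: real)" for j
  have Ds: "has_dir_derivative (axis j 1) s (\<lambda>_. \<delta> j)" for j
    using has_dir_derivative_diff[OF has_dir_derivative_vec_nth[OF has_dir_derivative_ident]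
        has_dir_derivative_const, of "axis j 1" i "a $ i"]
    unfolding s_def by (auto simp: \<delta>_def axis_def)
  have R_line: "R (y + t *\<^sub>R axis j 1) = R y + t *\<^sub>R (\<sigma> j *\<^sub>R axis j 1)" for y j t
    by (auto simp: R_def s_def \<sigma>_def vec_eq_iff axis_def algebra_simps)
  have flip: "has_dir_derivative (axis j 1) (\<lambda>y. F (R y)) (\<lambda>y. \<sigma> j * G (R y))"
    if "has_dir_derivative (axis j 1) F G" for F G :: "real^'n \<Rightarrow> real" and j
  proof (rule has_dir_derivative_affine[where g = "\<lambda>x. \<sigma> j * G x", OF _ R_line])
    show "has_dir_derivative (\<sigma> j *\<^sub>R axis j 1) F (\<lambda>x. \<sigma> j * G x)"
      using that has_dir_derivative_uminus[OF that] by (cases "j = i") (simp_all add: \<sigma>_def)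
  qed
  have \<sigma>\<sigma>: "\<sigma> j * (\<sigma> j * x) = x" for j x by (simp add: \<sigma>_def)
  have Dy: "has_dir_derivative (axis j 1) (\<lambda>y. y - a) (\<lambda>y. axis j 1)" for j
    using has_dir_derivative_diff[OF has_dir_derivative_ident has_dir_derivative_const] by simp
  have Ds2: "has_dir_derivative (axis j 1) (\<lambda>y. 2 - s y) (\<lambda>y. - \<delta> j)" for j
    using has_dir_derivative_diff[OF has_dir_derivative_const Ds] by simp
  \<comment> \<open>Both derivatives are left unsimplified, in exactly the shape that the
    differentiation rules produce.\<close>
  define w1 where "w1 j y = (g j y - \<sigma> j * g j (R y)) - K * (s y * - \<delta> j + \<delta> j * (2 - s y))
     - (1 / 2) * ((y - a) \<bullet> axis j 1 + axis j 1 \<bullet> (y - a))" for j y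
  define w2 where "w2 j y = (h j y - \<sigma> j * (\<sigma> j * h j (R y)))
     - K * ((s y * 0 + \<delta> j * - \<delta> j) + (\<delta> j * - \<delta> j + 0 * (2 - s y)))
     - (1 / 2) * (((y - a) \<bullet> 0 + axis j 1 \<bullet> (axis j 1 :: real^'n))
        + (axis j 1 \<bullet> (axis j 1 :: real^'n) + 0 \<bullet> (y - a)))" for j y
  have W1: "has_dir_derivative (axis j 1) w (w1 j)" for j
    unfolding w_def w1_def
    by (intro has_dir_derivative_diff has_dir_derivative_mult D1 flip has_dir_derivative_inner Dy
        has_dir_derivative_bilinear[OF bounded_bilinear_mult] Ds Ds2)
  have W2: "has_dir_derivative (axis j 1) (w1 j) (w2 j)" for j
    unfolding w1_def w2_def
    by (intro has_dir_derivative_diff has_dir_derivative_add has_dir_derivative_mult D2 flip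
        has_dir_derivative_inner Dy has_dir_derivative_const
        has_dir_derivative_bilinear[OF bounded_bilinear_mult] Ds Ds2)
  have contw: "continuous_on UNIV w"
    unfolding w_def R_def s_def
    by (intro continuous_intros continuous_on_compose2[OF cont]) auto
  define T where "T = {y. 0 \<le> s y \<and> s y \<le> 1}"
  have T: "closed T"
    unfolding T_def s_def by (intro closed_Collect_conj closed_Collect_le continuous_intros)
  define U where "U = {y. 0 < s y \<and> s y < 1}"
  have U: "open U"
    unfolding U_def s_def by (intro open_Collect_conj open_Collect_less continuous_intros)
  have w_le: "w y \<le> 2 * A - K * (s y * (2 - s y)) - (norm (y - a))\<^sup>2 / 2" for y
    using A[of y] A[of "R y"] by (simp add: w_def power2_norm_eq_inner)
  have sT: "0 \<le> K * (s y * (2 - s y))" if "y \<in> T" for y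
    using that \<open>0 \<le> K\<close> by (simp add: T_def)
  have "w y \<le> 0" if yT: "y \<in> T" for y
  proof (rule ccontr)
    assume "\<not> w y \<le> 0"
    then have y: "0 < w y" by simp
    \<comment> \<open>Beyond this radius the quadratic term alone outweighs
      \<open>2 * A\<close>.\<close>
    define r where "r = 2 * sqrt A"
    have out: "w z \<le> 0" if "z \<in> T" "z \<notin> cball a r" for z
    proof -
      have "r \<le> norm (z - a)" using that by (simp add: dist_norm norm_minus_commute)
      then have "r\<^sup>2 \<le> (norm (z - a))\<^sup>2"
        using \<open>0 \<le> A\<close> by (intro power_mono) (auto simp: r_def)
      then show ?thesis
        using w_le[of z] sT[OF that(1)] \<open>0 \<le> A\<close> by (simp add: r_def power_mult_distrib)
    qed
    have "y \<in> cball a r" using out[of y] y yT by force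
    moreover have "w z \<le> w y" if "z \<in> T" "z \<notin> cball a r" for z
      using out[OF that] y by linarith
    ultimately obtain x where x: "x \<in> T" "\<And>z. z \<in> T \<Longrightarrow> w z \<le> w x"
      using attains_sup_if_le_outside_cball[OF T continuous_on_subset[OF contw subset_UNIV] yT]
      by blast
    have wx: "0 < w x" using x(2)[OF yT] y by simp
    have "s x \<noteq> 0"
    proof
      assume "s x = 0"
      then have "R x = x" by (simp add: R_def)
      then show False using wx \<open>s x = 0\<close> inner_ge_zero[of "x - a"] by (simp add: w_def)
    qed
    moreover have "s x \<noteq> 1"
    proof
      assume "s x = 1"
      then have "w x \<le> 2 * A - K - (norm (x - a))\<^sup>2 / 2" using w_le[of x] by simp
      also have "\<dots> \<le> 0"
        using \<open>0 \<le> B\<close> zero_le_power2[of "norm (x - a)"] unfolding K_def by linarith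
      finally show False using wx by simp
    qed
    ultimately have "x \<in> U" using x(1) by (auto simp: T_def U_def)
    have w2: "w2 j x \<le> 0" for j
    proof (rule second_dir_derivative_nonpos_at_max[OF W1 W2])
      have "((\<lambda>t. x + t *\<^sub>R axis j 1) \<longlongrightarrow> x + 0 *\<^sub>R axis j 1) (at 0)"
        by (intro tendsto_intros)
      then have "eventually (\<lambda>t. x + t *\<^sub>R axis j 1 \<in> U) (at 0)"
        using U \<open>x \<in> U\<close> by (intro topological_tendstoD) auto
      then show "eventually (\<lambda>t. w (x + t *\<^sub>R axis j 1) \<le> w x) (at 0)"
        by eventually_elim (auto intro!: x(2) simp: U_def T_def)
    qed
    \<comment> \<open>Summed over j, the Laplacians of \<open>f\<close> at the two points contribute
      at least \<open>- 2 * B\<close>, the barrier \<open>2 * K\<close> and the quadratic term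
      \<open>- CARD('n)\<close>; the choice of \<open>K\<close> makes the total positive.\<close>
    have "w2 j x = h j x - h j (R x) + 2 * K * \<delta> j - 1" for j
      by (simp add: w2_def \<sigma>\<sigma> inner_axis_axis \<delta>_def)
    then have "(\<Sum>j\<in>UNIV. w2 j x) = (\<Sum>j\<in>UNIV. h j x) - (\<Sum>j\<in>UNIV. h j (R x)) + 2 * K - CARD('n)"
      by (simp add: sum.distrib sum_subtractf sum_distrib_left[symmetric] \<delta>_def)
    moreover have "(\<Sum>j\<in>UNIV. w2 j x) \<le> 0" using w2 by (intro sum_nonpos)
    ultimately have "2 * K \<le> 2 * B + CARD('n)" using B[of x] B[of "R x"] by linarith
    then have "real CARD('n) + 4 * A \<le> 0" by (simp add: K_def)
    moreover have "0 < real CARD('n) + 4 * A" using \<open>0 \<le> A\<close> by (intro add_pos_nonneg) auto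
    ultimately show False by simp
  qed
  moreover have s: "s (a + t *\<^sub>R axis i 1) = t" by (simp add: s_def)
  ultimately have "w (a + t *\<^sub>R axis i 1) \<le> 0" using t by (auto simp: T_def)
  moreover have "R (a + t *\<^sub>R axis i 1) = a - t *\<^sub>R axis i 1"
    by (simp add: R_def s algebra_simps scaleR_2[symmetric])
  ultimately have "f (a + t *\<^sub>R axis i 1) - f (a - t *\<^sub>R axis i 1) \<le> K * (t * (2 - t)) + t * t / 2"
    by (simp add: w_def s inner_axis_axis)
  also have "\<dots> \<le> K * (2 * t) + 2 * t"
  proof (intro add_mono mult_left_mono \<open>0 \<le> K\<close>)
    have "t * t \<le> t * 1" using t by (intro mult_left_mono) auto
    then show "t * (2 - t) \<le> 2 * t" "t * t / 2 \<le> 2 * t" using t by (auto simp: algebra_simps)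
  qed
  finally show ?thesis by (simp add: K_def algebra_simps)
qed

text \<open>The symmetric difference of \<open>f\<close> about \<open>a\<close> has derivative
  \<open>2 * g i a\<close> at \<open>t = 0\<close>, while the reflection estimate bounds it by a
  multiple of \<open>t\<close>.\<close>

lemma dir_derivative_le_of_bounded_laplacian:
  fixes f :: "real^'n::finite \<Rightarrow> real" and A B :: real
  assumes D1: "\<And>j. has_dir_derivative (axis j 1) f (g j)"
    and D2: "\<And>j. has_dir_derivative (axis j 1) (g j) (h j)"
    and cont: "continuous_on UNIV f"
    and A: "\<And>x. \<bar>f x\<bar> \<le> A" and B: "\<And>x. \<bar>\<Sum>j\<in>UNIV. h j x\<bar> \<le> B"
  shows "g i a \<le> 2 * A + B + CARD('n) + 1"
proof (rule ccontr)
  define K where "K = 2 * A + B + CARD('n) + 1"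
  assume "\<not> g i a \<le> 2 * A + B + CARD('n) + 1"
  then have pos: "0 < g i a - (- g i a) - 2 * K" by (simp add: K_def)
  have "((\<lambda>t. f (a + t *\<^sub>R axis i 1) - f (a + t *\<^sub>R - axis i 1) - 2 * K * t) has_real_derivative
      g i a - (- g i a) - 2 * K) (at 0)"
    using has_dir_derivativeD[OF D1[of i], of a 0]
      has_dir_derivativeD[OF has_dir_derivative_uminus[OF D1[of i]], of a 0]
    by (auto intro!: derivative_eq_intros simp: has_real_derivative_iff_has_vector_derivative[symmetric])
  from DERIV_pos_inc_right[OF this pos] obtain d where d: "d > 0"
    "\<And>t. 0 < t \<Longrightarrow> t < d \<Longrightarrow> 0 < f (a + t *\<^sub>R axis i 1) - f (a - t *\<^sub>R axis i 1) - 2 * K * t"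
    by auto
  define t where "t = min (d / 2) 1"
  have t: "0 < t" "t < d" "t \<le> 1" using d(1) by (auto simp: t_def)
  have "f (a + t *\<^sub>R axis i 1) - f (a - t *\<^sub>R axis i 1) \<le> 2 * K * t"
    unfolding K_def by (rule reflection_difference_le[OF D1 D2 cont A B]) (use t in auto)
  then show False using d(2)[OF t(1,2)] by simp
qed

text \<open>The one-sided scalar bound is applied to each component of \<open>u\<close> and to its
  negative; the factor \<open>CARD('m)\<close> comes from estimating the norm by the sum of the
  components.\<close>

lemma bounded_gradient_of_bounded_laplacian:
  fixes u :: "real^'n::finite \<Rightarrow> real^'m::finite" and A B :: real
  assumes u: "Ck 2 u" and A: "\<And>x. norm (u x) \<le> A" and B: "\<And>x. norm (laplacian u x) \<le> B"
  shows "norm (pderivative i u x) \<le> CARD('m) * (2 * A + B + CARD('n) + 1)"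
proof -
  have u': "Ck (Suc (Suc 0)) u" using u by (simp only: numeral_2_eq_2)
  note D1 = Ck_has_dir_derivative(1)[OF u']
  note D2 = Ck_has_dir_derivative(1)[OF Ck_has_dir_derivative(2)[OF u']]
  have "\<bar>pderivative i u x $ k\<bar> \<le> 2 * A + B + CARD('n) + 1" for k
  proof (rule abs_leI)
    note D1k = has_dir_derivative_vec_nth[OF D1, of _ k]
    note D2k = has_dir_derivative_vec_nth[OF D2, of _ _ k]
    have cont: "continuous_on UNIV (\<lambda>x. u x $ k)"
      by (intro continuous_intros Ck_continuous[OF u])
    have Ak: "\<bar>u x $ k\<bar> \<le> A" for x using A[of x] component_le_norm_cart order_trans by blast
    have "(\<Sum>j\<in>UNIV. pderivative j (pderivative j u) x $ k) = laplacian u x $ k" for x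
      by (simp add: laplacian_def)
    then have Bk: "\<bar>\<Sum>j\<in>UNIV. pderivative j (pderivative j u) x $ k\<bar> \<le> B" for x
      using B[of x] component_le_norm_cart order_trans by metis
    show "pderivative i u x $ k \<le> 2 * A + B + CARD('n) + 1"
      by (rule dir_derivative_le_of_bounded_laplacian[OF D1k D2k cont Ak Bk])
    note neg = has_dir_derivative_bounded_linear[OF bounded_linear_minus[OF bounded_linear_ident]]
    show "- (pderivative i u x $ k) \<le> 2 * A + B + CARD('n) + 1"
      by (rule dir_derivative_le_of_bounded_laplacian[OF neg[OF D1k] neg[OF D2k]])
        (use Ak Bk cont in \<open>auto simp: sum_negf intro: continuous_intros\<close>)
  qed
  then have "(\<Sum>k\<in>UNIV. \<bar>pderivative i u x $ k\<bar>) \<le> (\<Sum>k\<in>(UNIV::'m set). 2 * A + B + CARD('n) + 1)"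
    by (intro sum_mono)
  then show ?thesis using norm_le_l1_cart[of "pderivative i u x"] by simp
qed

section \<open>The P-function\<close>

text \<open>The order of the two partial derivatives is the one that arises from differentiating
  component \<open>k\<close> of the gradient in direction \<open>l\<close>.\<close>

definition hessian_apply :: "(real^'n::finite \<Rightarrow> real) \<Rightarrow> real^'n \<Rightarrow> real^'n \<Rightarrow> real^'n"
  where "hessian_apply W v \<xi> = (\<chi> k. \<Sum>l\<in>UNIV. \<xi> $ l * pderivative l (pderivative k W) v)"

lemma hessian_apply_inner: "hessian_apply W v \<xi> \<bullet> \<eta> = hessian_form W v \<xi> \<eta>"
proof -
  have "hessian_apply W v \<xi> \<bullet> \<eta> =
      (\<Sum>k\<in>UNIV. \<Sum>l\<in>UNIV. pderivative l (pderivative k W) v * \<xi> $ l * \<eta> $ k)"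
    by (simp add: hessian_apply_def inner_vec_def sum_distrib_left sum_distrib_right mult_ac)
  also have "\<dots> = hessian_form W v \<xi> \<eta>"
    unfolding hessian_form_def by (rule sum.swap)
  finally show ?thesis .
qed

lemma has_derivative_gradient:
  assumes "Ck 1 W"
  shows "(W has_derivative (\<lambda>\<xi>. gradient W v \<bullet> \<xi>)) (at v)"
  using Ck1_has_derivative[OF assms, of v] by (simp add: gradient_def inner_vec_def mult.commute)

lemma gradient_has_derivative_hessian:
  assumes "Ck 2 W"
  shows "(gradient W has_derivative hessian_apply W v) (at v)"
proof -
  have "Ck 1 (pderivative k W)" for k
    using assms Ck_has_dir_derivative(2)[of 1 W] by (simp add: numeral_2_eq_2)
  then have "((\<lambda>x. gradient W x \<bullet> axis k 1) has_derivative (\<lambda>\<xi>. hessian_apply W v \<xi> \<bullet> axis k 1)) (at v)" for k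
    using Ck1_has_derivative[of "pderivative k W" v]
    by (simp add: gradient_def hessian_apply_def inner_axis)
  then show ?thesis
    by (subst has_derivative_componentwise_within) (auto simp: Basis_vec_def)
qed

lemma continuous_on_gradient:
  assumes "Ck (Suc k) W"
  shows "continuous_on UNIV (gradient W)"
  unfolding gradient_def
  by (intro continuous_intros Ck_continuous[OF Ck_has_dir_derivative(2)[OF assms]])

lemma continuous_on_hessian_apply:
  fixes W :: "real^'m::finite \<Rightarrow> real"
  assumes W: "Ck 2 W" and f: "continuous_on UNIV f" and g: "continuous_on UNIV g"
  shows "continuous_on UNIV (\<lambda>x. hessian_apply W (f x) (g x))"
proof -
  have "continuous_on UNIV (pderivative l (pderivative k W))" for k l
    using W by (simp add: numeral_2_eq_2)
  then show ?thesis
    unfolding hessian_apply_def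
    by (intro continuous_intros continuous_on_compose2[OF _ f] g) auto
qed

text \<open>Cauchy-Schwarz against the constant 1. It compares the Laplacian with the pure second
  derivatives and is the source of the threshold n/2.\<close>

lemma norm_sum_power2_le_card:
  fixes a :: "'i::finite \<Rightarrow> 'a::real_inner"
  shows "(norm (\<Sum>i\<in>UNIV. a i))\<^sup>2 \<le> CARD('i) * (\<Sum>i\<in>UNIV. (norm (a i))\<^sup>2)"
proof -
  have "(norm (\<Sum>i\<in>UNIV. a i))\<^sup>2 \<le> (\<Sum>i\<in>UNIV. norm (a i) * 1)\<^sup>2"
    by (intro power_mono) (auto intro: norm_sum)
  also have "\<dots> \<le> (\<Sum>i\<in>UNIV. (norm (a i))\<^sup>2) * (\<Sum>i\<in>(UNIV::'i set). 1\<^sup>2)"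
    by (rule Cauchy_Schwarz_ineq_sum)
  finally show ?thesis by (simp add: mult.commute)
qed

text \<open>Since \<open>u\<close> is only \<open>C\<^sup>2\<close>, the function \<open>\<bar>\<nabla>u\<bar>\<^sup>2\<close> has no second derivatives. They are replaced by
  those of the sum of squared difference quotients; the maximisers of the regularised functions
  stay in a fixed ball and accumulate at the point \<open>x\<close>.\<close>

lemma maximum_point_inequality:
  fixes W :: "real^'m::finite \<Rightarrow> real" and u :: "real^'n::finite \<Rightarrow> real^'m"
    and A L c \<delta> \<eta> :: real
  assumes W: "Ck 2 W" "\<And>v. 0 \<le> W v" and u: "Ck 2 u" "\<And>x. norm (u x) \<le> A"
    and L: "\<And>i x. norm (pderivative i u x) \<le> L"
    and pde: "\<And>x. laplacian u x = gradient W (u x)"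
    and c: "0 \<le> c" and \<delta>: "0 \<le> \<delta>" and \<eta>: "0 < \<eta>"
  defines "Q \<equiv> \<lambda>x. c * grad_norm_sq u x - W (u x) + \<delta> / 2 * (norm (u x))\<^sup>2 - \<eta> * (norm x)\<^sup>2"
  obtains x where "\<And>y. Q y \<le> Q x"
    and "2 * c * (\<Sum>i\<in>UNIV. (norm (pderivative i (pderivative i u) x))\<^sup>2)
      + (2 * c - 1) * (\<Sum>i\<in>UNIV. hessian_form W (u x) (pderivative i u x) (pderivative i u x))
      - (norm (gradient W (u x)))\<^sup>2
      + \<delta> * (grad_norm_sq u x + u x \<bullet> gradient W (u x)) \<le> 2 * \<eta> * CARD('n)"
proof -
  define E where "E j = (axis j 1 :: real^'n)" for j
  define U where "U i = pderivative i u" for i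
  define V where "V j i = pderivative j (U i)" for i j
  define G where "G x = gradient W (u x)" for x
  define H where "H j x = hessian_apply W (u x) (U j x)" for j x
  have u': "Ck (Suc (Suc 0)) u" and W': "Ck 1 W"
    using u(1) W(1) by (simp_all add: numeral_2_eq_2)
  have DU: "has_dir_derivative (E j) u (U j)" for j
    unfolding E_def U_def by (rule Ck_has_dir_derivative(1)[OF u'])
  have DV: "has_dir_derivative (E j) (U i) (V j i)" for i j
    unfolding E_def V_def U_def
    by (rule Ck_has_dir_derivative(1)[OF Ck_has_dir_derivative(2)[OF u']])
  have DW: "has_dir_derivative (E j) (\<lambda>x. W (u x)) (\<lambda>x. G x \<bullet> U j x)" for j
    unfolding G_def by (rule has_dir_derivative_compose[OF DU has_derivative_gradient[OF W']])
  have DG: "has_dir_derivative (E j) G (H j)" for j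
    unfolding G_def H_def
    by (rule has_dir_derivative_compose[OF DU gradient_has_derivative_hessian[OF W(1)]])
  have cu: "continuous_on UNIV u" by (rule Ck_continuous[OF u(1)])
  have cU: "continuous_on UNIV (U i)" for i
    unfolding U_def by (rule Ck_continuous[OF Ck_has_dir_derivative(2)[OF u']])
  have cV: "continuous_on UNIV (V j i)" for i j
    unfolding V_def U_def
    by (rule Ck_continuous[OF Ck_has_dir_derivative(2)[OF Ck_has_dir_derivative(2)[OF u']]])
  have cG: "continuous_on UNIV G"
    unfolding G_def using continuous_on_gradient[of 0 W] W'
    by (intro continuous_on_compose2[OF _ cu]) auto
  have cH: "continuous_on UNIV (H j)" for j
    unfolding H_def by (intro continuous_on_hessian_apply W(1) cu cU)
  have cW: "continuous_on UNIV (\<lambda>x. W (u x))"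
    using Ck_continuous[OF W'] by (rule continuous_on_compose2[OF _ cu]) auto
  have lap: "(\<lambda>x. \<Sum>j\<in>UNIV. V j j x) = G"
    using pde by (simp add: laplacian_def G_def V_def U_def fun_eq_iff)

  define D where "D h i f = diff_quotient h (E i) f" for h :: real and i and f :: "real^'n \<Rightarrow> real^'m"
  have DD: "has_dir_derivative (E j) (D h i f) (D h i g)" if "has_dir_derivative (E j) f g" for f g h i j
    unfolding D_def by (rule has_dir_derivative_diff_quotient[OF that])
  \<comment> \<open>The regularisation of \<open>Q\<close>; \<open>q1\<close> and \<open>q2\<close>
    are its first and second derivatives in direction \<open>j\<close>, again as the rules deliver
    them.\<close>
  define q where "q h x = c * (\<Sum>i\<in>UNIV. D h i u x \<bullet> D h i u x) - W (u x)
    + \<delta> / 2 * (u x \<bullet> u x) - \<eta> * (x \<bullet> x)" for h x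
  define q1 where "q1 h j x = c * (\<Sum>i\<in>UNIV. D h i u x \<bullet> D h i (U j) x + D h i (U j) x \<bullet> D h i u x)
    - G x \<bullet> U j x + \<delta> / 2 * (u x \<bullet> U j x + U j x \<bullet> u x) - \<eta> * (x \<bullet> E j + E j \<bullet> x)" for h j x
  define q2 where "q2 h j x = c * (\<Sum>i\<in>UNIV.
        (D h i u x \<bullet> D h i (V j j) x + D h i (U j) x \<bullet> D h i (U j) x)
      + (D h i (U j) x \<bullet> D h i (U j) x + D h i (V j j) x \<bullet> D h i u x))
    - (G x \<bullet> V j j x + H j x \<bullet> U j x)
    + \<delta> / 2 * ((u x \<bullet> V j j x + U j x \<bullet> U j x) + (U j x \<bullet> U j x + V j j x \<bullet> u x))
    - \<eta> * ((x \<bullet> 0 + E j \<bullet> E j) + (E j \<bullet> E j + 0 \<bullet> x))" for h j x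
  have q1: "has_dir_derivative (E j) (q h) (q1 h j)" for h j
    unfolding q_def q1_def
    by (intro has_dir_derivative_diff has_dir_derivative_add has_dir_derivative_mult
        has_dir_derivative_sum has_dir_derivative_inner has_dir_derivative_ident DD DU DW)
  have q2: "has_dir_derivative (E j) (q1 h j) (q2 h j)" for h j
    unfolding q1_def q2_def
    by (intro has_dir_derivative_diff has_dir_derivative_add has_dir_derivative_mult
        has_dir_derivative_sum has_dir_derivative_inner has_dir_derivative_ident
        has_dir_derivative_const DD DU DV DG)
  have contq: "continuous_on UNIV (q h)" for h
    unfolding q_def D_def
    by (intro continuous_intros continuous_on_diff_quotient cu cW)

  define M where "M = c * (CARD('n) * L\<^sup>2) + \<delta> / 2 * A\<^sup>2"
  \<comment> \<open>Outside this ball \<open>q h\<close> is at most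
    \<open>M - \<eta> * r\<^sup>2 = - W (u 0)\<close>, hence at most \<open>q h 0\<close>. The
    radius is independent of \<open>h\<close>.\<close>
  define r where "r = sqrt ((M + W (u 0)) / \<eta>)"
  have "0 \<le> M" using c \<delta> by (simp add: M_def)
  have q_upper: "q h x \<le> M - \<eta> * (norm x)\<^sup>2" if "h \<noteq> 0" for h x
  proof -
    have "D h i u x \<bullet> D h i u x \<le> L\<^sup>2" for i
    proof -
      have "norm (D h i u x) \<le> L"
        unfolding D_def by (rule norm_diff_quotient_le[OF DU _ that]) (simp add: L U_def)
      then show ?thesis by (simp add: power2_norm_eq_inner[symmetric] power_mono)
    qed
    then have "(\<Sum>i\<in>UNIV. D h i u x \<bullet> D h i u x) \<le> (\<Sum>i\<in>(UNIV::'n set). L\<^sup>2)"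
      by (intro sum_mono)
    then have "c * (\<Sum>i\<in>UNIV. D h i u x \<bullet> D h i u x) \<le> c * (CARD('n) * L\<^sup>2)"
      using c by (intro mult_left_mono) auto
    moreover have "\<delta> / 2 * (u x \<bullet> u x) \<le> \<delta> / 2 * A\<^sup>2"
      using \<delta> u(2)[of x] by (intro mult_left_mono) (auto simp: power2_norm_eq_inner[symmetric] power_mono)
    ultimately show ?thesis
      using W(2)[of "u x"] by (simp add: q_def M_def power2_norm_eq_inner)
  qed
  have q_lower: "- W (u 0) \<le> q h 0" for h
    using c \<delta> by (simp add: q_def sum_nonneg)
  have "\<exists>x\<in>cball 0 r. \<forall>y. q h y \<le> q h x" if "h \<noteq> 0" for h
  proof -
    have out: "q h y \<le> q h 0" if "y \<notin> cball 0 r" for y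
    proof -
      have "r \<le> norm y" "0 \<le> r" using that W(2)[of "u 0"] \<open>0 \<le> M\<close> \<eta> by (auto simp: r_def)
      then have "r\<^sup>2 \<le> (norm y)\<^sup>2" by (rule power_mono)
      moreover have "r\<^sup>2 = (M + W (u 0)) / \<eta>" using W(2)[of "u 0"] \<open>0 \<le> M\<close> \<eta> by (simp add: r_def)
      ultimately have "M + W (u 0) \<le> \<eta> * (norm y)\<^sup>2" using \<eta> by (simp add: divide_le_eq mult.commute)
      then show ?thesis using q_upper[OF \<open>h \<noteq> 0\<close>, of y] q_lower[of h] by linarith
    qed
    have "0 \<in> cball 0 r" using W(2)[of "u 0"] \<open>0 \<le> M\<close> \<eta> by (auto simp: r_def)
    from attains_sup_if_le_outside_cball[OF closed_UNIV contq UNIV_I this out] show ?thesis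
      by (metis UNIV_I)
  qed
  then obtain Y where Y: "\<And>h. h \<noteq> 0 \<Longrightarrow> Y h \<in> cball 0 r" "\<And>h y. h \<noteq> 0 \<Longrightarrow> q h y \<le> q h (Y h)"
    by metis
  \<comment> \<open>A lower bound for the Laplacian of \<open>q h\<close>: of the squares of all
    \<open>D h i (U j)\<close> only those with i = j are kept.\<close>
  define z where "z h x = 2 * c * (\<Sum>i\<in>UNIV. D h i u x \<bullet> D h i G x)
    + 2 * c * (\<Sum>i\<in>UNIV. D h i (U i) x \<bullet> D h i (U i) x) - G x \<bullet> G x - (\<Sum>j\<in>UNIV. H j x \<bullet> U j x)
    + \<delta> * (u x \<bullet> G x + (\<Sum>j\<in>UNIV. U j x \<bullet> U j x)) - 2 * \<eta> * CARD('n)" for h x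
  have z: "z h (Y h) \<le> 0" if "h \<noteq> 0" for h
  proof -
    define x where "x = Y h"
    have "q2 h j x \<le> 0" for j
      by (rule second_dir_derivative_nonpos_at_max[OF q1 q2]) (simp add: Y(2)[OF that] x_def)
    then have "(\<Sum>j\<in>UNIV. q2 h j x) \<le> 0" by (intro sum_nonpos)
    moreover have "q2 h j x = 2 * c * (\<Sum>i\<in>UNIV. D h i u x \<bullet> D h i (V j j) x)
        + 2 * c * (\<Sum>i\<in>UNIV. D h i (U j) x \<bullet> D h i (U j) x)
        - G x \<bullet> V j j x - H j x \<bullet> U j x + \<delta> * (u x \<bullet> V j j x) + \<delta> * (U j x \<bullet> U j x) - 2 * \<eta>" for j
      by (simp add: q2_def E_def inner_axis_axis inner_commute sum.distrib sum_distrib_left[symmetric] algebra_simps)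
    \<comment> \<open>Here the equation replaces third derivatives of \<open>u\<close>: summing over
      j first turns the quotients of second derivatives into quotients of \<open>G\<close>, which is
      differentiable.\<close>
    moreover have "(\<Sum>j\<in>UNIV. \<Sum>i\<in>UNIV. D h i u x \<bullet> D h i (V j j) x) = (\<Sum>i\<in>UNIV. D h i u x \<bullet> D h i G x)"
      by (subst sum.swap) (simp add: inner_sum_right[symmetric] D_def diff_quotient_sum lap)
    moreover have "(\<Sum>j\<in>UNIV. V j j x) = G x" using lap by (simp add: fun_eq_iff)
    ultimately have "2 * c * (\<Sum>i\<in>UNIV. D h i u x \<bullet> D h i G x)
        + 2 * c * (\<Sum>j\<in>UNIV. \<Sum>i\<in>UNIV. D h i (U j) x \<bullet> D h i (U j) x)
        - G x \<bullet> G x - (\<Sum>j\<in>UNIV. H j x \<bullet> U j x) + \<delta> * (u x \<bullet> G x)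
        + \<delta> * (\<Sum>j\<in>UNIV. U j x \<bullet> U j x) - 2 * \<eta> * CARD('n) \<le> 0"
      by (simp add: sum.distrib sum_subtractf sum_distrib_left[symmetric] inner_sum_right[symmetric] mult_ac)
    moreover have "2 * c * (\<Sum>i\<in>UNIV. D h i (U i) x \<bullet> D h i (U i) x)
        \<le> 2 * c * (\<Sum>j\<in>UNIV. \<Sum>i\<in>UNIV. D h i (U j) x \<bullet> D h i (U j) x)"
    proof (intro mult_left_mono sum_mono)
      fix j show "D h j (U j) x \<bullet> D h j (U j) x \<le> (\<Sum>i\<in>UNIV. D h i (U j) x \<bullet> D h i (U j) x)"
        by (rule member_le_sum[where f = "\<lambda>i. D h i (U j) x \<bullet> D h i (U j) x"]) auto
    qed (use c in auto)
    ultimately show ?thesis by (simp add: z_def x_def[symmetric] distrib_left)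
  qed

  \<comment> \<open>Step sizes tend to 0 and the maximisers converge along a subsequence; both the
    maximality and the inequality for \<open>z\<close> pass to the limit.\<close>
  define h where "h k = inverse (real (Suc k))" for k
  have h: "h k \<noteq> 0" for k by (simp add: h_def)
  have "compact (cball (0::real^'n) r)" by simp
  then obtain x s where s: "strict_mono (s :: nat \<Rightarrow> nat)" "((\<lambda>k. Y (h k)) \<circ> s) \<longlonglongrightarrow> x"
    using Y(1)[OF h] unfolding compact_def by metis
  define X where "X k = Y (h (s k))" for k
  have X: "X \<longlonglongrightarrow> x" using s(2) by (simp add: X_def[abs_def] o_def)
  have h0: "(\<lambda>k. h (s k)) \<longlonglongrightarrow> 0"
    using LIMSEQ_subseq_LIMSEQ[OF LIMSEQ_inverse_real_of_nat s(1)] by (simp add: h_def o_def)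
  have lim: "(\<lambda>k. f (Z k)) \<longlonglongrightarrow> f l" if "continuous_on UNIV f" "Z \<longlonglongrightarrow> l"
    for f :: "real^'n \<Rightarrow> 'c::real_normed_vector" and Z l
    by (rule continuous_on_tendsto_compose[OF that]) auto
  have limW: "(\<lambda>k. W (u (Z k))) \<longlonglongrightarrow> W (u l)" if "Z \<longlonglongrightarrow> l" for Z l
    using lim[OF cW that] .
  have limD: "(\<lambda>k. D (h (s k)) i f (Z k)) \<longlonglongrightarrow> g l"
    if "has_dir_derivative (E i) f g" "continuous_on UNIV g" "Z \<longlonglongrightarrow> l" for f g i Z l
    unfolding D_def by (rule diff_quotient_tendsto[OF that h0 h])
  have Q_eq: "Q y = c * (\<Sum>i\<in>UNIV. U i y \<bullet> U i y) - W (u y) + \<delta> / 2 * (u y \<bullet> u y) - \<eta> * (y \<bullet> y)" for y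
    by (simp add: Q_def grad_norm_sq_def U_def power2_norm_eq_inner)
  have limq: "(\<lambda>k. q (h (s k)) (Z k)) \<longlonglongrightarrow> Q l" if "Z \<longlonglongrightarrow> l" for Z l
    unfolding q_def Q_eq
    by (intro tendsto_intros limD[OF DU cU] limW lim[OF cu] that)
  have "(\<lambda>k. z (h (s k)) (X k)) \<longlonglongrightarrow> 2 * c * (\<Sum>i\<in>UNIV. U i x \<bullet> H i x)
    + 2 * c * (\<Sum>i\<in>UNIV. V i i x \<bullet> V i i x) - G x \<bullet> G x - (\<Sum>j\<in>UNIV. H j x \<bullet> U j x)
    + \<delta> * (u x \<bullet> G x + (\<Sum>j\<in>UNIV. U j x \<bullet> U j x)) - 2 * \<eta> * CARD('n)"
    unfolding z_def
    by (intro tendsto_intros limD[OF DU cU] limD[OF DG cH] limD[OF DV cV] lim[OF cu] lim[OF cU]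
        lim[OF cG] lim[OF cH] X)
  then have "2 * c * (\<Sum>i\<in>UNIV. U i x \<bullet> H i x)
    + 2 * c * (\<Sum>i\<in>UNIV. V i i x \<bullet> V i i x) - G x \<bullet> G x - (\<Sum>j\<in>UNIV. H j x \<bullet> U j x)
    + \<delta> * (u x \<bullet> G x + (\<Sum>j\<in>UNIV. U j x \<bullet> U j x)) - 2 * \<eta> * CARD('n) \<le> 0"
    by (rule LIMSEQ_le_const2) (use z[OF h] in \<open>auto simp: X_def\<close>)
  moreover have "H i x \<bullet> U i x = hessian_form W (u x) (U i x) (U i x)" for i
    by (simp add: H_def hessian_apply_inner)
  ultimately have main: "2 * c * (\<Sum>i\<in>UNIV. (norm (V i i x))\<^sup>2)
      + (2 * c - 1) * (\<Sum>i\<in>UNIV. hessian_form W (u x) (U i x) (U i x))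
      - (norm (G x))\<^sup>2 + \<delta> * (grad_norm_sq u x + u x \<bullet> G x) \<le> 2 * \<eta> * CARD('n)"
    by (simp add: inner_commute[of "U _ x" "H _ x"] grad_norm_sq_def U_def[symmetric]
        power2_norm_eq_inner algebra_simps)
  have max: "Q y \<le> Q x" for y
    by (rule LIMSEQ_le[OF limq[OF tendsto_const] limq[OF X]]) (use Y(2)[OF h] in \<open>auto simp: X_def\<close>)
  show ?thesis
    using that[OF max] main by (simp add: V_def U_def G_def)
qed

text \<open>At the perturbed maximum point everything reduces to a quadratic polynomial in
  \<open>d\<close>, the norm of the Laplacian there, whose upper and lower bounds contradict each
  other.\<close>

lemma grad_norm_sq_le_potential:
  fixes W :: "real^'m::finite \<Rightarrow> real" and u :: "real^'n::finite \<Rightarrow> real^'m" and A c :: real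
  assumes W: "Ck 2 W" "\<And>v. 0 \<le> W v" and u: "Ck 2 u" "\<And>x. norm (u x) \<le> A"
    and pde: "\<And>x. laplacian u x = gradient W (u x)"
    and convex: "\<And>v \<xi>. v \<in> F \<Longrightarrow> 0 \<le> hessian_form W v \<xi> \<xi>"
    and c: "CARD('n) / 2 < c"
    and outside: "\<And>x. u x \<notin> F \<Longrightarrow> c * grad_norm_sq u x \<le> W (u x)"
  shows "c * grad_norm_sq u y \<le> W (u y)"
proof (rule ccontr)
  define m where "m = c * grad_norm_sq u y - W (u y)"
  define n where "n = real CARD('n)"
  assume "\<not> ?thesis"
  then have m: "0 < m" by (simp add: m_def)
  have n: "1 \<le> n" by (simp add: n_def Suc_leI)
  have c1: "0 < c" "1 \<le> 2 * c" using c n unfolding n_def by linarith+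
  \<comment> \<open>The share of the squared Laplacian left after its negative occurrence is
    absorbed by the second derivatives.\<close>
  define \<kappa> where "\<kappa> = 2 * c / n - 1"
  have \<kappa>: "0 < \<kappa>" using c n by (simp add: \<kappa>_def n_def field_simps)
  have "0 \<le> A" using u(2)[of 0] norm_ge_zero order_trans by blast
  \<comment> \<open>A strictly positive bound, so that division by it is possible.\<close>
  define A' where "A' = A + 1"
  have A': "0 < A'" "\<And>x. norm (u x) \<le> A'"
    using \<open>0 \<le> A\<close> u(2) by (auto simp: A'_def intro: add_increasing2)
  have "continuous_on (cball 0 A') (gradient W)"
    using continuous_on_gradient[of 1 W] W(1) by (auto simp: numeral_2_eq_2 intro: continuous_on_subset)
  then have "bounded (gradient W ` cball 0 A')"
    by (intro compact_imp_bounded compact_continuous_image) auto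
  then obtain B where "\<And>v. v \<in> cball 0 A' \<Longrightarrow> norm (gradient W v) \<le> B"
    unfolding bounded_iff by blast
  then have "norm (laplacian u x) \<le> B" for x using A'(2)[of x] by (simp add: pde)
  note L = bounded_gradient_of_bounded_laplacian[OF u this]

  \<comment> \<open>The first entry keeps the perturbation at most \<open>m / 8\<close>; the second
    makes the discriminant of the final quadratic in \<open>d\<close> nonpositive.\<close>
  define \<delta> where "\<delta> = min (m / (4 * A'\<^sup>2)) (m * \<kappa> / (c * A'\<^sup>2))"
  have \<delta>: "0 < \<delta>" using m \<kappa> c1 A' by (simp add: \<delta>_def)
  have \<delta>1: "\<delta> * A'\<^sup>2 \<le> m / 4" 
  proof -
    have "\<delta> * A'\<^sup>2 \<le> m / (4 * A'\<^sup>2) * A'\<^sup>2" by (intro mult_right_mono) (auto simp: \<delta>_def)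
    then show ?thesis using A'(1) by simp
  qed
  have \<delta>2: "\<delta> * A'\<^sup>2 * c \<le> m * \<kappa>" 
  proof -
    have "\<delta> * (A'\<^sup>2 * c) \<le> m * \<kappa> / (c * A'\<^sup>2) * (A'\<^sup>2 * c)"
      using c1(1) by (intro mult_right_mono) (auto simp: \<delta>_def)
    then show ?thesis using A'(1) c1(1) by simp
  qed
  \<comment> \<open>The first entry costs at most \<open>m / 4\<close> at \<open>y\<close>; the
    second makes the error \<open>2 * \<eta> * n\<close> a quarter or less of the gain
    \<open>\<delta> * m / (2 * c)\<close>.\<close>
  define \<eta> where "\<eta> = min (m / (4 * ((norm y)\<^sup>2 + 1))) (\<delta> * m / (16 * c * n))"
  have \<eta>: "0 < \<eta>" using m \<delta> c1 n by (simp add: \<eta>_def add_nonneg_pos)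
  have "\<eta> * ((norm y)\<^sup>2 + 1) \<le> m / 4"
  proof -
    have "m / (4 * N) * N = m / 4" if "0 < N" for N using that by simp
    from this[of "(norm y)\<^sup>2 + 1"]
    have "m / (4 * ((norm y)\<^sup>2 + 1)) * ((norm y)\<^sup>2 + 1) = m / 4" by (simp add: add_nonneg_pos)
    then show ?thesis
      using mult_right_mono[of \<eta> "m / (4 * ((norm y)\<^sup>2 + 1))" "(norm y)\<^sup>2 + 1"] by (simp add: \<eta>_def)
  qed
  then have \<eta>1: "\<eta> * (norm y)\<^sup>2 \<le> m / 4" using \<eta> by (simp add: distrib_left)
  have \<eta>2: "2 * \<eta> * n \<le> \<delta> * m / (8 * c)"
  proof -
    have "\<eta> * (2 * n) \<le> \<delta> * m / (16 * c * n) * (2 * n)"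
      using n by (intro mult_right_mono) (auto simp: \<eta>_def)
    also have "\<dots> = \<delta> * m / (8 * c)" using n c1 by (simp add: field_simps)
    finally show ?thesis by simp
  qed

  obtain x where max: "\<And>y. c * grad_norm_sq u y - W (u y) + \<delta> / 2 * (norm (u y))\<^sup>2 - \<eta> * (norm y)\<^sup>2
      \<le> c * grad_norm_sq u x - W (u x) + \<delta> / 2 * (norm (u x))\<^sup>2 - \<eta> * (norm x)\<^sup>2"
    and ineq: "2 * c * (\<Sum>i\<in>UNIV. (norm (pderivative i (pderivative i u) x))\<^sup>2)
      + (2 * c - 1) * (\<Sum>i\<in>UNIV. hessian_form W (u x) (pderivative i u x) (pderivative i u x))
      - (norm (gradient W (u x)))\<^sup>2
      + \<delta> * (grad_norm_sq u x + u x \<bullet> gradient W (u x)) \<le> 2 * \<eta> * CARD('n)"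
    by (rule maximum_point_inequality[OF W u L pde less_imp_le[OF c1(1)] less_imp_le[OF \<delta>] \<eta>])
      (rule that)
  have "\<delta> / 2 * (norm (u x))\<^sup>2 \<le> \<delta> / 2 * A'\<^sup>2"
    using \<delta> A' by (intro mult_left_mono power_mono) auto
  moreover have "0 \<le> \<delta> / 2 * (norm (u y))\<^sup>2" "0 \<le> \<eta> * (norm x)\<^sup>2" using \<delta> \<eta> by auto
  ultimately have P: "m / 2 \<le> c * grad_norm_sq u x - W (u x)"
    using max[of y] \<delta>1 \<eta>1 m unfolding m_def[symmetric] by linarith
  then have "u x \<in> F" using outside[of x] m by force
  then have conv: "0 \<le> (2 * c - 1) * (\<Sum>i\<in>UNIV. hessian_form W (u x) (pderivative i u x) (pderivative i u x))"
    using c1(2) by (intro mult_nonneg_nonneg sum_nonneg convex) auto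
  define d where "d = norm (gradient W (u x))"
  have "d\<^sup>2 \<le> n * (\<Sum>i\<in>UNIV. (norm (pderivative i (pderivative i u) x))\<^sup>2)"
    unfolding d_def n_def pde[symmetric] laplacian_def by (rule norm_sum_power2_le_card)
  then have "2 * c / n * d\<^sup>2 \<le> 2 * c / n * (n * (\<Sum>i\<in>UNIV. (norm (pderivative i (pderivative i u) x))\<^sup>2))"
    using c1 n by (intro mult_left_mono) auto
  then have hess: "(\<kappa> + 1) * d\<^sup>2 \<le> 2 * c * (\<Sum>i\<in>UNIV. (norm (pderivative i (pderivative i u) x))\<^sup>2)"
    using n by (simp add: \<kappa>_def)
  have "\<bar>u x \<bullet> gradient W (u x)\<bar> \<le> norm (u x) * d" unfolding d_def by (rule Cauchy_Schwarz_ineq2)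
  also have "\<dots> \<le> A' * d" using A'(2) by (intro mult_right_mono) (auto simp: d_def)
  finally have "- (\<delta> * (A' * d)) \<le> \<delta> * (u x \<bullet> gradient W (u x))"
    using \<delta> mult_left_mono[of "- (A' * d)" "u x \<bullet> gradient W (u x)" \<delta>] by auto
  moreover have "m / (2 * c) \<le> grad_norm_sq u x"
    using P W(2)[of "u x"] c1 by (simp add: field_simps)
  then have "\<delta> * (m / (2 * c)) \<le> \<delta> * grad_norm_sq u x" using \<delta> by (intro mult_left_mono) auto
  ultimately have "\<kappa> * d\<^sup>2 - \<delta> * A' * d + \<delta> * m / (2 * c) \<le> \<delta> * m / (8 * c)"
    using ineq conv hess \<eta>2 unfolding d_def[symmetric] n_def[symmetric] by (simp add: algebra_simps)
  \<comment> \<open>Completing the square. Only half of the gain is spent, and the other half still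
    exceeds the error.\<close>
  moreover have "\<kappa> * d\<^sup>2 - \<delta> * A' * d + \<delta> * m / (4 * c) \<ge> 0"
  proof -
    have "0 \<le> (2 * \<kappa> * d - \<delta> * A')\<^sup>2" by simp
    moreover have "\<delta> * (\<delta> * A'\<^sup>2 * c) \<le> \<delta> * (m * \<kappa>)" using \<delta> \<delta>2 by (intro mult_left_mono) auto
    then have "(\<delta> * A')\<^sup>2 \<le> \<kappa> * (\<delta> * m / c)"
      using c1 by (simp add: field_simps power2_eq_square)
    ultimately have "0 \<le> 4 * \<kappa> * (\<kappa> * d\<^sup>2 - \<delta> * A' * d + \<delta> * m / (4 * c))"
      by (simp add: power2_eq_square algebra_simps)
    then show ?thesis using \<kappa> by (simp add: zero_le_mult_iff)
  qed
  moreover have "0 < \<delta> * m / c" using \<delta> m c1 by simp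
  ultimately show False by simp
qed

section \<open>Constancy, pointwise boundedness and the theorem\<close>

lemma grad_norm_sq_zero_imp_constant:
  fixes u :: "real^'n::finite \<Rightarrow> real^'m::finite"
  assumes u: "Ck 1 u" and zero: "\<And>x. grad_norm_sq u x = 0"
  shows "u constant_on UNIV"
proof -
  have "pderivative i u x = 0" for i x
    using zero[of x] by (simp add: grad_norm_sq_def sum_nonneg_eq_0_iff)
  then have "(u has_derivative (\<lambda>v. 0)) (at x within UNIV)" for x
    using Ck1_has_derivative[OF u, of x] by simp
  then have "\<exists>c. \<forall>x\<in>UNIV. u x = c"
    by (intro has_derivative_zero_constant) auto
  then show ?thesis by (simp add: constant_on_def)
qed

text \<open>By continuity the set where the essential bound fails is open; being negligible, it is
  empty.\<close>

lemma L_infinity_continuous_bounded: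
  fixes u :: "real^'n::finite \<Rightarrow> 'b::real_normed_vector"
  assumes "L_infinity u" and cont: "continuous_on UNIV u"
  obtains A where "\<And>x. norm (u x) \<le> A"
proof -
  obtain A where "AE x in lebesgue. norm (u x) \<le> A"
    using assms(1) by (auto simp: L_infinity_def)
  then obtain N where N: "{x. \<not> norm (u x) \<le> A} \<subseteq> N" "N \<in> null_sets lebesgue"
    by (auto simp: eventually_ae_filter)
  have "negligible {x. A < norm (u x)}"
    using N by (metis (no_types, lifting) Collect_cong negligible_iff_null_sets negligible_subset not_le)
  moreover have "open {x. A < norm (u x)}"
    by (intro open_Collect_less continuous_intros cont)
  ultimately have "{x. A < norm (u x)} = {}"
    using open_not_negligible by blast
  then show ?thesis using that[of A] by (auto simp: not_less[symmetric])
qed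

theorem theorem3p5:
  fixes W :: "real^'m::finite \<Rightarrow> real"
    and F :: "(real^'m) set"
    and u :: "real^'n::finite \<Rightarrow> real^'m"
    and \<alpha> :: real
    and \<epsilon> S :: ereal
  assumes "0 < \<alpha>" and "\<alpha> < 1"
    and "C2_hoelder \<alpha> W"
    and "\<And>v. 0 \<le> W v"
    and "closed F"
    and "\<And>v \<xi>. v \<in> F \<Longrightarrow> 0 \<le> hessian_form W v \<xi> \<xi>"
    and "Ck 2 u" and "L_infinity u"
    and "\<And>x. laplacian u x = gradient W (u x)"
    and "\<epsilon> = inf_outside W F"
    and "S = sup_grad_outside u F"
  shows "(u -` (- F) \<noteq> {} \<and> 0 < S \<and> S < 2 * \<epsilon> / ereal (real CARD('n)) \<longrightarrow>
           (\<forall>x. ereal (real CARD('n) / 2 * grad_norm_sq u x) \<le> \<epsilon> / S * ereal (grad_norm_sq u x) \<and>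
                \<epsilon> / S * ereal (grad_norm_sq u x) \<le> ereal (W (u x)))) \<and>
         ((u -` (- F) \<noteq> {} \<and> S = 0) \<or> range u \<subseteq> F \<longrightarrow> u constant_on UNIV)"
proof -
  have W: "Ck 2 W" using assms(3) by (simp add: C2_hoelder_def)
  obtain A where A: "\<And>x. norm (u x) \<le> A"
    using L_infinity_continuous_bounded[OF assms(8) Ck_continuous[OF assms(7)]] by blast
  have bound: "c * grad_norm_sq u y \<le> W (u y)"
    if "CARD('n) / 2 < c" "\<And>x. u x \<notin> F \<Longrightarrow> c * grad_norm_sq u x \<le> W (u x)" for c y
  proof (rule grad_norm_sq_le_potential[OF W assms(4,7) A assms(9), where F = F and c = c])
    show "0 \<le> hessian_form W v \<xi> \<xi>" if "v \<in> F" for v \<xi> by (rule assms(6)[OF that])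
  qed (rule that; assumption)+
  have grad0: "0 \<le> grad_norm_sq u x" for x by (simp add: grad_norm_sq_def sum_nonneg)
  have S_upper: "ereal (grad_norm_sq u x) \<le> S" if "u x \<notin> F" for x
    unfolding assms(11) sup_grad_outside_def using that by (intro SUP_upper) auto
  have \<epsilon>_lower: "\<epsilon> \<le> ereal (W (u x))" if "u x \<notin> F" for x
    unfolding assms(10) inf_outside_def using that by (intro INF_lower) auto
  have \<epsilon>0: "0 \<le> \<epsilon>"
    unfolding assms(10) inf_outside_def using assms(4) by (intro INF_greatest) auto
  \<comment> \<open>This hypothesis covers both degenerate cases: it holds vacuously if the range of
    \<open>u\<close> lies in \<open>F\<close>.\<close>
  have "u constant_on UNIV" if out0: "\<And>x. u x \<notin> F \<Longrightarrow> grad_norm_sq u x = 0"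
  proof (rule grad_norm_sq_zero_imp_constant)
    show "Ck 1 u" using assms(7) by (simp add: numeral_2_eq_2)
    fix y show "grad_norm_sq u y = 0"
    proof (rule ccontr)
      assume "grad_norm_sq u y \<noteq> 0"
      then have pos: "0 < grad_norm_sq u y" using grad0[of y] by simp
      \<comment> \<open>Every large constant is admissible, as the outside condition reads
        \<open>0 \<le> W (u x)\<close>; this one makes the left side exceed \<open>W (u y)\<close>
        by \<open>CARD('n) * grad_norm_sq u y\<close>.\<close>
      define c where "c = CARD('n) + W (u y) / grad_norm_sq u y"
      have "CARD('n) / 2 < c"
        using pos assms(4)[of "u y"] by (simp add: c_def add_strict_increasing2 add_pos_nonneg)
      then have "c * grad_norm_sq u y \<le> W (u y)"
        by (rule bound) (simp_all add: out0 assms(4))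
      then show False using pos by (simp add: c_def distrib_right mult_le_0_iff)
    qed
  qed
  moreover have "grad_norm_sq u x = 0" if "S = 0" "u x \<notin> F" for x
    using S_upper[OF that(2)] that(1) grad0[of x] by simp
  moreover have "ereal (real CARD('n) / 2 * grad_norm_sq u x) \<le> \<epsilon> / S * ereal (grad_norm_sq u x) \<and>
                \<epsilon> / S * ereal (grad_norm_sq u x) \<le> ereal (W (u x))"
    if nonempty: "u -` (- F) \<noteq> {}" and S: "0 < S" "S < 2 * \<epsilon> / ereal (real CARD('n))" for x
  proof -
    obtain x0 where x0: "u x0 \<notin> F" using nonempty by auto
    \<comment> \<open>A point where \<open>u\<close> leaves \<open>F\<close> makes the infimum
      finite, and the strict upper bound then makes the supremum finite.\<close>
    obtain e where e: "\<epsilon> = ereal e" using \<epsilon>_lower[OF x0] \<epsilon>0 by (cases \<epsilon>) auto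
    obtain s where s: "S = ereal s" using S by (cases S) (auto simp: e)
    have "0 < s" "s < 2 * e / CARD('n)" using S by (auto simp: e s)
    then have c: "CARD('n) / 2 < e / s" by (simp add: field_simps)
    have out: "e / s * grad_norm_sq u z \<le> W (u z)" if "u z \<notin> F" for z
    proof -
      have "0 \<le> e" using \<epsilon>0 by (simp add: e)
      then have "e / s * grad_norm_sq u z \<le> e / s * s"
        using S_upper[OF that] \<open>0 < s\<close> by (intro mult_left_mono) (auto simp: s)
      also have "\<dots> \<le> W (u z)" using \<epsilon>_lower[OF that] \<open>0 < s\<close> by (simp add: e)
      finally show ?thesis .
    qed
    have "e / s * grad_norm_sq u x \<le> W (u x)" by (rule bound[OF c]) (rule out)
    moreover have "CARD('n) / 2 * grad_norm_sq u x \<le> e / s * grad_norm_sq u x"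
      using c grad0 by (intro mult_right_mono) auto
    ultimately show ?thesis using \<open>0 < s\<close> by (simp add: e s)
  qed
  ultimately show ?thesis by blast
qed

end
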